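(* Let $\Psi\colon\mathbb{L}^2\to\mathbb{L}^2$, $\Psi\mathcal{G}=Y(T,\cdot,\mathcal{G})$, be the input-output operator, where $Y(t,\cdot,\mathcal{G})=(y,y_\Gamma)$ is the mild solution, with initial datum $\mathcal{G}\in\mathbb{L}^2$, of $$\begin{cases}\partial_t y-d\Delta y=0 & \text{in }(0,T)\times\Omega,\\ \partial_t y_\Gamma-\gamma\Delta_\Gamma y_\Gamma+d\,\partial_\nu y=0 & \text{on }(0,T)\times\Gamma,\\ y_\Gamma=y_{|\Gamma} & \text{on }(0,T)\times\Gamma,\\ (y,y_\Gamma)|_{t=0}=\mathcal{G}.\end{cases}$$ Then $\Psi$ is self-adjoint. Moreover, for every $k\ge1$, $$\Psi\phi_k=e^{-\lambda_kT}\phi_k ,$$ where $(\phi_k)_{k\ge1}$ is the orthonormal basis of $\mathbb{L}^2$ consisting of eigenfunctions of $-\mathcal{A}_0$ corresponding to the eigenvalues $(\lambda_k)_{k\ge1}$.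
   Context: Setting: $T>0$; $\Omega\subset\mathbb{R}^N$ ($N\ge1$) is a bounded domain with boundary $\Gamma=\partial\Omega$ of class $C^2$; $d>0$, and $\gamma>0$ if $N\ge2$, with the convention $\gamma=0$ if $N=1$ (then $\Gamma$ consists of two points). $\Delta$ is the Laplacian, $\Delta_\Gamma$ the Laplace–Beltrami operator on $\Gamma$, $\nu$ the unit outward normal, $\partial_\nu y=(\nabla y\cdot\nu)_{|\Gamma}$, $y_{|\Gamma}$ the trace. $\mathbb{L}^2=L^2(\Omega,dx)\times L^2(\Gamma,dS)$ is the real Hilbert space with inner product $\langle(y,y_\Gamma),(z,z_\Gamma)\rangle=\langle y,z\rangle_{L^2(\Omega)}+\langle y_\Gamma,z_\Gamma\rangle_{L^2(\Gamma)}$, and $\mathbb{H}^2=\{(y,y_\Gamma)\in H^2(\Omega)\times H^2(\Gamma): y_{|\Gamma}=y_\Gamma\}$. $\mathcal{A}_0(y,y_\Gamma)=(d\Delta y,\,-d\,\partial_\nu y+\gamma\Delta_\Gamma y_\Gamma)$ with domain $D(\mathcal{A}_0)=\mathbb{H}^2$ generates an analytic $C_0$-semigroup $(e^{t\mathcal{A}_0})_{t\ge0}$ on $\mathbb{L}^2$, and the mild solution above is $Y(t,\cdot,\mathcal{G})=e^{t\mathcal{A}_0}\mathcal{G}$. The operator $-\mathcal{A}_0$ is self-adjoint, nonnegative and has compact resolvent; $(\lambda_k)_{k\ge1}$ denotes its eigenvalues in nondecreasing order (repeated according to multiplicity), with $\lambda_1=0$ and $\lambda_k\to\infty$, and $(\phi_k)_{k\ge1}$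 an orthonormal basis of $\mathbb{L}^2$ with $-\mathcal{A}_0\phi_k=\lambda_k\phi_k$. *)

theory Defs
  imports "HOL-Analysis.Analysis"
begin

text \<open>
  Elements of \<open>L\<^sup>2\<close> spaces are represented by square-integrable functions, equality in
  \<open>L\<^sup>2\<close> by equality almost everywhere. Operators that are only determined up to null sets
  (weak derivatives, traces) pick a representative by Hilbert choice; every statement about their
  values below is invariant under changing the representative.
\<close>

section \<open>Functions of class \<open>C\<^sup>k\<close>, bounded domains with \<open>C\<^sup>2\<close> boundary\<close>

definition pd :: "'a::euclidean_space \<Rightarrow> ('a \<Rightarrow> real) \<Rightarrow> 'a \<Rightarrow> real" where
  "pd i f x = frechet_derivative f (at x) i"

text \<open>For open \<open>U\<close>.\<close>

fun Ck_on :: "nat \<Rightarrow> 'a::euclidean_space set \<Rightarrow> ('a \<Rightarrow> real) \<Rightarrow> bool" where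
  "Ck_on 0 U f \<longleftrightarrow> continuous_on U f"
| "Ck_on (Suc k) U f \<longleftrightarrow> f differentiable_on U \<and> (\<forall>i\<in>Basis. Ck_on k U (pd i f))"

text \<open>
  Near \<open>p\<close> the set \<open>\<Omega>\<close> is, with respect to the \<open>e\<close>-axis, the strict epigraph of a function of the
  orthogonal variables; such a function is encoded as a function on the whole space that is
  constant along \<open>e\<close>.
\<close>

definition C2_epigraph_at ::
  "'a::euclidean_space set \<Rightarrow> 'a \<Rightarrow> real \<Rightarrow> 'a \<Rightarrow> ('a \<Rightarrow> real) \<Rightarrow> bool" where
  "C2_epigraph_at \<Omega> p r e g \<longleftrightarrow>
     r > 0 \<and> norm e = 1 \<and> Ck_on 2 UNIV g \<and> (\<forall>x t. g (x + t *\<^sub>R e) = g x) \<and>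
     \<Omega> \<inter> ball p r = {x \<in> ball p r. g x < x \<bullet> e}"

definition C2_bounded_domain :: "'a::euclidean_space set \<Rightarrow> bool" where
  "C2_bounded_domain \<Omega> \<longleftrightarrow>
     open \<Omega> \<and> connected \<Omega> \<and> \<Omega> \<noteq> {} \<and> bounded \<Omega> \<and>
     (\<forall>p\<in>frontier \<Omega>. \<exists>r e g. C2_epigraph_at \<Omega> p r e g)"

text \<open>
  Locally \<open>\<Omega> = {x. g x - x \<bullet> e < 0}\<close>, so the outward unit normal is the normalized
  gradient of \<open>g x - x \<bullet> e\<close>.
\<close>

definition outward_normal :: "'a::euclidean_space set \<Rightarrow> 'a \<Rightarrow> 'a" where
  "outward_normal \<Omega> p =
     (THE n. \<exists>r e g w. C2_epigraph_at \<Omega> p r e g \<and> GDERIV (\<lambda>x. g x - x \<bullet> e) p :> w \<and>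
                       n = w /\<^sub>R norm w)"


section \<open>Surface measure\<close>

definition hausdorff_gauge :: "nat \<Rightarrow> 'a::euclidean_space set \<Rightarrow> ennreal" where
  "hausdorff_gauge s C =
     (if C = {} then 0 else ennreal (unit_ball_vol (real s) * (diameter C / 2) ^ s))"

definition hausdorff_outer :: "nat \<Rightarrow> 'a::euclidean_space set \<Rightarrow> ennreal" where
  "hausdorff_outer s A =
     (SUP \<delta>\<in>{0<..}. INF C\<in>{C :: nat \<Rightarrow> 'a set. A \<subseteq> (\<Union>i. C i) \<and>
                                   (\<forall>i. bounded (C i) \<and> diameter (C i) \<le> (\<delta>::real))}.
        (\<Sum>i. hausdorff_gauge s (C i)))"

definition hausdorff_measure :: "nat \<Rightarrow> 'a::euclidean_space measure" where
  "hausdorff_measure s = measure_of UNIV (sets borel) (hausdorff_outer s)"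

text \<open>In dimension one this is the counting measure on the two end points.\<close>

definition surface_measure :: "'a::euclidean_space set \<Rightarrow> 'a measure" where
  "surface_measure \<Omega> = restrict_space (hausdorff_measure (DIM('a) - 1)) (frontier \<Omega>)"


section \<open>The spaces \<open>L\<^sup>2(\<Omega>)\<close>, \<open>L\<^sup>2(\<Gamma>)\<close> and their product\<close>

definition sq_integrable :: "'b measure \<Rightarrow> ('b \<Rightarrow> real) set" where
  "sq_integrable M = {f \<in> borel_measurable M. integrable M (\<lambda>x. (f x)\<^sup>2)}"

definition L2_inner :: "'b measure \<Rightarrow> ('b \<Rightarrow> real) \<Rightarrow> ('b \<Rightarrow> real) \<Rightarrow> real" where
  "L2_inner M f g = (\<integral>x. f x * g x \<partial>M)"

definition L2_dist :: "'b measure \<Rightarrow> ('b \<Rightarrow> real) \<Rightarrow> ('b \<Rightarrow> real) \<Rightarrow> real" where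
  "L2_dist M f g = sqrt (\<integral>x. (f x - g x)\<^sup>2 \<partial>M)"

type_synonym 'a state = "('a \<Rightarrow> real) \<times> ('a \<Rightarrow> real)"

definition LL2 :: "'a::euclidean_space set \<Rightarrow> 'a state set" where
  "LL2 \<Omega> = sq_integrable (lebesgue_on \<Omega>) \<times> sq_integrable (surface_measure \<Omega>)"

definition LL2_eq :: "'a::euclidean_space set \<Rightarrow> 'a state \<Rightarrow> 'a state \<Rightarrow> bool" where
  "LL2_eq \<Omega> F G \<longleftrightarrow>
     (AE x in lebesgue_on \<Omega>. fst F x = fst G x) \<and> (AE p in surface_measure \<Omega>. snd F p = snd G p)"

definition LL2_inner :: "'a::euclidean_space set \<Rightarrow> 'a state \<Rightarrow> 'a state \<Rightarrow> real" where
  "LL2_inner \<Omega> F G =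
     L2_inner (lebesgue_on \<Omega>) (fst F) (fst G) + L2_inner (surface_measure \<Omega>) (snd F) (snd G)"

definition LL2_norm :: "'a::euclidean_space set \<Rightarrow> 'a state \<Rightarrow> real" where
  "LL2_norm \<Omega> F = sqrt (LL2_inner \<Omega> F F)"

definition st_scale :: "real \<Rightarrow> 'a state \<Rightarrow> 'a state" where
  "st_scale c F = ((\<lambda>x. c * fst F x), (\<lambda>x. c * snd F x))"

definition st_add :: "'a state \<Rightarrow> 'a state \<Rightarrow> 'a state" where
  "st_add F G = ((\<lambda>x. fst F x + fst G x), (\<lambda>x. snd F x + snd G x))"

definition st_diff :: "'a state \<Rightarrow> 'a state \<Rightarrow> 'a state" where
  "st_diff F G = ((\<lambda>x. fst F x - fst G x), (\<lambda>x. snd F x - snd G x))"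

definition st_sum :: "('k \<Rightarrow> 'a state) \<Rightarrow> 'k set \<Rightarrow> 'a state" where
  "st_sum F K = ((\<lambda>x. \<Sum>k\<in>K. fst (F k) x), (\<lambda>x. \<Sum>k\<in>K. snd (F k) x))"


section \<open>Sobolev spaces on \<open>\<Omega>\<close>, traces, normal derivative\<close>

definition test_fun :: "'a::euclidean_space set \<Rightarrow> ('a \<Rightarrow> real) \<Rightarrow> bool" where
  "test_fun \<Omega> \<phi> \<longleftrightarrow> (\<forall>k. Ck_on k UNIV \<phi>) \<and>
     compact (closure {x. \<phi> x \<noteq> 0}) \<and> closure {x. \<phi> x \<noteq> 0} \<subseteq> \<Omega>"

definition has_weak_pd ::
  "'a::euclidean_space set \<Rightarrow> 'a \<Rightarrow> ('a \<Rightarrow> real) \<Rightarrow> ('a \<Rightarrow> real) \<Rightarrow> bool" where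
  "has_weak_pd \<Omega> i u v \<longleftrightarrow>
     u \<in> sq_integrable (lebesgue_on \<Omega>) \<and> v \<in> sq_integrable (lebesgue_on \<Omega>) \<and>
     (\<forall>\<phi>. test_fun \<Omega> \<phi> \<longrightarrow>
        (\<integral>x. u x * pd i \<phi> x \<partial>lebesgue_on \<Omega>) = - (\<integral>x. v x * \<phi> x \<partial>lebesgue_on \<Omega>))"

definition weak_pd :: "'a::euclidean_space set \<Rightarrow> 'a \<Rightarrow> ('a \<Rightarrow> real) \<Rightarrow> 'a \<Rightarrow> real" where
  "weak_pd \<Omega> i u = (SOME v. has_weak_pd \<Omega> i u v)"

definition H1 :: "'a::euclidean_space set \<Rightarrow> ('a \<Rightarrow> real) set" where
  "H1 \<Omega> = {u \<in> sq_integrable (lebesgue_on \<Omega>). \<forall>i\<in>Basis. \<exists>v. has_weak_pd \<Omega> i u v}"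

definition H2 :: "'a::euclidean_space set \<Rightarrow> ('a \<Rightarrow> real) set" where
  "H2 \<Omega> = {u \<in> H1 \<Omega>. \<forall>i\<in>Basis. weak_pd \<Omega> i u \<in> H1 \<Omega>}"

definition laplacian :: "'a::euclidean_space set \<Rightarrow> ('a \<Rightarrow> real) \<Rightarrow> 'a \<Rightarrow> real" where
  "laplacian \<Omega> u x = (\<Sum>i\<in>Basis. weak_pd \<Omega> i (weak_pd \<Omega> i u) x)"

text \<open>
  The trace is the continuous extension to \<open>H\<^sup>1(\<Omega>)\<close> of the restriction to the boundary of
  functions that are \<open>C\<^sup>1\<close> up to the boundary.
\<close>

definition has_trace ::
  "'a::euclidean_space set \<Rightarrow> ('a \<Rightarrow> real) \<Rightarrow> ('a \<Rightarrow> real) \<Rightarrow> bool" where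
  "has_trace \<Omega> u g \<longleftrightarrow>
     u \<in> H1 \<Omega> \<and> g \<in> sq_integrable (surface_measure \<Omega>) \<and>
     (\<exists>w :: nat \<Rightarrow> 'a \<Rightarrow> real.
        (\<forall>n. Ck_on 1 UNIV (w n)) \<and>
        (\<lambda>n. L2_dist (lebesgue_on \<Omega>) (w n) u) \<longlonglongrightarrow> 0 \<and>
        (\<forall>i\<in>Basis. (\<lambda>n. L2_dist (lebesgue_on \<Omega>) (pd i (w n)) (weak_pd \<Omega> i u)) \<longlonglongrightarrow> 0) \<and>
        (\<lambda>n. L2_dist (surface_measure \<Omega>) (w n) g) \<longlonglongrightarrow> 0)"

definition trace_of :: "'a::euclidean_space set \<Rightarrow> ('a \<Rightarrow> real) \<Rightarrow> 'a \<Rightarrow> real" where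
  "trace_of \<Omega> u = (SOME g. has_trace \<Omega> u g)"

definition normal_deriv :: "'a::euclidean_space set \<Rightarrow> ('a \<Rightarrow> real) \<Rightarrow> 'a \<Rightarrow> real" where
  "normal_deriv \<Omega> u p = (\<Sum>i\<in>Basis. trace_of \<Omega> (weak_pd \<Omega> i u) p * (outward_normal \<Omega> p \<bullet> i))"


section \<open>Sobolev space \<open>H\<^sup>2(\<Gamma>)\<close> and Laplace--Beltrami operator\<close>

text \<open>
  The derivative within the boundary determines the gradient only modulo the normal direction,
  hence the orthogonality condition.
\<close>

definition tgrad :: "'a::euclidean_space set \<Rightarrow> ('a \<Rightarrow> real) \<Rightarrow> 'a \<Rightarrow> 'a" where
  "tgrad \<Omega> f p =
     (THE w. w \<bullet> outward_normal \<Omega> p = 0 \<and>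
             (f has_derivative (\<lambda>v. w \<bullet> v)) (at p within frontier \<Omega>))"

text \<open>The sum of the principal curvatures, that is the surface divergence of the normal.\<close>

definition mean_curvature :: "'a::euclidean_space set \<Rightarrow> 'a \<Rightarrow> real" where
  "mean_curvature \<Omega> p = (\<Sum>j\<in>Basis. tgrad \<Omega> (\<lambda>q. outward_normal \<Omega> q \<bullet> j) p \<bullet> j)"

text \<open>
  Weak form of \<open>v = D\<^sub>i f\<close>, where \<open>D\<^sub>i f = \<nabla>\<^sub>\<Gamma> f \<bullet> i\<close>. The curvature term stems from the
  integration by parts formula \<open>\<integral>\<^sub>\<Gamma> D\<^sub>i h dS = \<integral>\<^sub>\<Gamma> h H \<nu>\<^sub>i dS\<close> on the closed hypersurface \<open>\<Gamma>\<close>.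
  Every \<open>C\<^sup>1\<close> function on \<open>\<Gamma>\<close> is the restriction of some \<open>\<phi>\<close> as below.
\<close>

definition has_weak_td ::
  "'a::euclidean_space set \<Rightarrow> 'a \<Rightarrow> ('a \<Rightarrow> real) \<Rightarrow> ('a \<Rightarrow> real) \<Rightarrow> bool" where
  "has_weak_td \<Omega> i f v \<longleftrightarrow>
     f \<in> sq_integrable (surface_measure \<Omega>) \<and> v \<in> sq_integrable (surface_measure \<Omega>) \<and>
     (\<forall>\<phi>. Ck_on 1 UNIV \<phi> \<longrightarrow>
        (\<integral>p. f p * (tgrad \<Omega> \<phi> p \<bullet> i) \<partial>surface_measure \<Omega>) =
        - (\<integral>p. v p * \<phi> p \<partial>surface_measure \<Omega>)
        + (\<integral>p. f p * \<phi> p * mean_curvature \<Omega> p * (outward_normal \<Omega> p \<bullet> i) \<partial>surface_measure \<Omega>))"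

definition weak_td :: "'a::euclidean_space set \<Rightarrow> 'a \<Rightarrow> ('a \<Rightarrow> real) \<Rightarrow> 'a \<Rightarrow> real" where
  "weak_td \<Omega> i f = (SOME v. has_weak_td \<Omega> i f v)"

definition H1_bd :: "'a::euclidean_space set \<Rightarrow> ('a \<Rightarrow> real) set" where
  "H1_bd \<Omega> = {f \<in> sq_integrable (surface_measure \<Omega>). \<forall>i\<in>Basis. \<exists>v. has_weak_td \<Omega> i f v}"

definition H2_bd :: "'a::euclidean_space set \<Rightarrow> ('a \<Rightarrow> real) set" where
  "H2_bd \<Omega> = {f \<in> H1_bd \<Omega>. \<forall>i\<in>Basis. weak_td \<Omega> i f \<in> H1_bd \<Omega>}"

text \<open>
  Surface divergence of the tangential gradient. In dimension one all tangential derivatives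
  vanish, so that \<open>H\<^sup>2(\<Gamma>) = L\<^sup>2(\<Gamma>)\<close> and the operator is zero.
\<close>

definition laplace_beltrami :: "'a::euclidean_space set \<Rightarrow> ('a \<Rightarrow> real) \<Rightarrow> 'a \<Rightarrow> real" where
  "laplace_beltrami \<Omega> f p = (\<Sum>i\<in>Basis. weak_td \<Omega> i (weak_td \<Omega> i f) p)"


section \<open>The operator \<open>\<A>\<^sub>0\<close>\<close>

definition HH2 :: "'a::euclidean_space set \<Rightarrow> 'a state set" where
  "HH2 \<Omega> = {(y, y\<^sub>\<Gamma>). y \<in> H2 \<Omega> \<and> y\<^sub>\<Gamma> \<in> H2_bd \<Omega> \<and> has_trace \<Omega> y y\<^sub>\<Gamma>}"

definition A0 :: "'a::euclidean_space set \<Rightarrow> real \<Rightarrow> real \<Rightarrow> 'a state \<Rightarrow> 'a state" where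
  "A0 \<Omega> d \<gamma> Y =
     ((\<lambda>x. d * laplacian \<Omega> (fst Y) x),
      (\<lambda>p. - d * normal_deriv \<Omega> (fst Y) p + \<gamma> * laplace_beltrami \<Omega> (snd Y) p))"


section \<open>Operators and semigroups on \<open>\<bbbL>\<^sup>2\<close>\<close>

text \<open>Linearity and boundedness imply that the operator respects equality almost everywhere.\<close>

definition LL2_bounded_linear ::
  "'a::euclidean_space set \<Rightarrow> ('a state \<Rightarrow> 'a state) \<Rightarrow> bool" where
  "LL2_bounded_linear \<Omega> B \<longleftrightarrow>
     (\<forall>F\<in>LL2 \<Omega>. B F \<in> LL2 \<Omega>) \<and>
     (\<forall>F\<in>LL2 \<Omega>. \<forall>G\<in>LL2 \<Omega>. LL2_eq \<Omega> (B (st_add F G)) (st_add (B F) (B G))) \<and>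
     (\<forall>F\<in>LL2 \<Omega>. \<forall>c. LL2_eq \<Omega> (B (st_scale c F)) (st_scale c (B F))) \<and>
     (\<exists>K. \<forall>F\<in>LL2 \<Omega>. LL2_norm \<Omega> (B F) \<le> K * LL2_norm \<Omega> F)"

definition LL2_self_adjoint ::
  "'a::euclidean_space set \<Rightarrow> ('a state \<Rightarrow> 'a state) \<Rightarrow> bool" where
  "LL2_self_adjoint \<Omega> B \<longleftrightarrow>
     LL2_bounded_linear \<Omega> B \<and>
     (\<forall>F\<in>LL2 \<Omega>. \<forall>G\<in>LL2 \<Omega>. LL2_inner \<Omega> (B F) G = LL2_inner \<Omega> F (B G))"

definition C0_semigroup ::
  "'a::euclidean_space set \<Rightarrow> (real \<Rightarrow> 'a state \<Rightarrow> 'a state) \<Rightarrow> bool" where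
  "C0_semigroup \<Omega> S \<longleftrightarrow>
     (\<forall>t\<ge>0. LL2_bounded_linear \<Omega> (S t)) \<and>
     (\<forall>F\<in>LL2 \<Omega>. LL2_eq \<Omega> (S 0 F) F) \<and>
     (\<forall>s\<ge>0. \<forall>t\<ge>0. \<forall>F\<in>LL2 \<Omega>. LL2_eq \<Omega> (S (s + t) F) (S s (S t F))) \<and>
     (\<forall>F\<in>LL2 \<Omega>. \<forall>t\<ge>0.
        ((\<lambda>s. LL2_norm \<Omega> (st_diff (S s F) (S t F))) \<longlongrightarrow> 0) (at t within {0..}))"

text \<open>The graph of the infinitesimal generator.\<close>

definition generator_graph ::
  "'a::euclidean_space set \<Rightarrow> (real \<Rightarrow> 'a state \<Rightarrow> 'a state) \<Rightarrow> ('a state \<times> 'a state) set" where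
  "generator_graph \<Omega> S =
     {(F, Z). F \<in> LL2 \<Omega> \<and> Z \<in> LL2 \<Omega> \<and>
        ((\<lambda>h. LL2_norm \<Omega> (st_diff (st_scale (1 / h) (st_diff (S h F) F)) Z)) \<longlongrightarrow> 0) (at_right 0)}"

definition generated_by ::
  "'a::euclidean_space set \<Rightarrow> 'a state set \<Rightarrow> ('a state \<Rightarrow> 'a state) \<Rightarrow>
   (real \<Rightarrow> 'a state \<Rightarrow> 'a state) \<Rightarrow> bool" where
  "generated_by \<Omega> D A S \<longleftrightarrow>
     C0_semigroup \<Omega> S \<and>
     generator_graph \<Omega> S = {(F, Z). F \<in> D \<and> Z \<in> LL2 \<Omega> \<and> LL2_eq \<Omega> Z (A F)}"

definition generates_C0_semigroup ::
  "'a::euclidean_space set \<Rightarrow> 'a state set \<Rightarrow> ('a state \<Rightarrow> 'a state) \<Rightarrow> bool" where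
  "generates_C0_semigroup \<Omega> D A \<longleftrightarrow> (\<exists>S. generated_by \<Omega> D A S)"

text \<open>
  The semigroup generated by \<open>A\<close> with domain \<open>D\<close>; its values on \<open>LL2 \<Omega>\<close> are unique up to equality
  almost everywhere.
\<close>

definition exp_semigroup ::
  "'a::euclidean_space set \<Rightarrow> 'a state set \<Rightarrow> ('a state \<Rightarrow> 'a state) \<Rightarrow>
   real \<Rightarrow> 'a state \<Rightarrow> 'a state" where
  "exp_semigroup \<Omega> D A = (SOME S. generated_by \<Omega> D A S)"

definition mild_solution ::
  "'a::euclidean_space set \<Rightarrow> real \<Rightarrow> real \<Rightarrow> 'a state \<Rightarrow> real \<Rightarrow> 'a state" where
  "mild_solution \<Omega> d \<gamma> G t = exp_semigroup \<Omega> (HH2 \<Omega>) (A0 \<Omega> d \<gamma>) t G"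

definition input_output ::
  "'a::euclidean_space set \<Rightarrow> real \<Rightarrow> real \<Rightarrow> real \<Rightarrow> 'a state \<Rightarrow> 'a state" where
  "input_output \<Omega> d \<gamma> T G = mild_solution \<Omega> d \<gamma> G T"


section \<open>Orthonormal bases of eigenfunctions\<close>

text \<open>Sequences are indexed by \<open>k \<ge> 1\<close>; the values at \<open>0\<close> are irrelevant.\<close>

definition LL2_orthonormal_basis ::
  "'a::euclidean_space set \<Rightarrow> (nat \<Rightarrow> 'a state) \<Rightarrow> bool" where
  "LL2_orthonormal_basis \<Omega> \<phi> \<longleftrightarrow>
     (\<forall>k\<ge>1. \<phi> k \<in> LL2 \<Omega>) \<and>
     (\<forall>j\<ge>1. \<forall>k\<ge>1. LL2_inner \<Omega> (\<phi> j) (\<phi> k) = (if j = k then 1 else 0)) \<and>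
     (\<forall>F\<in>LL2 \<Omega>.
        (\<lambda>n. LL2_norm \<Omega> (st_diff F (st_sum (\<lambda>k. st_scale (LL2_inner \<Omega> F (\<phi> k)) (\<phi> k)) {1..n})))
          \<longlonglongrightarrow> 0)"

text \<open>
  Since the eigenfunctions form an orthonormal basis, each eigenvalue is automatically repeated
  according to its multiplicity.
\<close>

definition eigenbasis ::
  "'a::euclidean_space set \<Rightarrow> real \<Rightarrow> real \<Rightarrow> (nat \<Rightarrow> real) \<Rightarrow> (nat \<Rightarrow> 'a state) \<Rightarrow> bool" where
  "eigenbasis \<Omega> d \<gamma> lam \<phi> \<longleftrightarrow>
     LL2_orthonormal_basis \<Omega> \<phi> \<and>
     (\<forall>k\<ge>1. \<phi> k \<in> HH2 \<Omega> \<and>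
        LL2_eq \<Omega> (st_scale (-1) (A0 \<Omega> d \<gamma> (\<phi> k))) (st_scale (lam k) (\<phi> k))) \<and>
     mono_on {1..} lam \<and> lam 1 = 0 \<and> filterlim lam at_top sequentially"

end

theory Submission
  imports Defs
begin

text \<open>
  Write \<open>S\<close> for the semigroup generated by \<open>\<A>\<^sub>0\<close>, so that the input-output operator is \<open>S T\<close>. Each
  eigenfunction \<open>\<phi>\<^sub>k\<close> lies in the domain of the generator of \<open>S\<close> and is mapped by it to \<open>-\<lambda>\<^sub>k \<phi>\<^sub>k\<close>;
  from this fact and the completeness of \<open>\<phi>\<close> the result follows by Hilbert space theory.

  Action on eigenfunctions: for fixed \<open>G\<close> the scalar function \<open>t \<mapsto> \<langle>S t \<phi>\<^sub>k, G\<rangle>\<close> is continuous, and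
  since \<open>S (t + h) = S t \<circ> S h\<close> and \<open>S t\<close> is bounded, its right derivative at every \<open>t\<close> is \<open>-\<lambda>\<^sub>k\<close> times
  its value (lemma \<open>orbit_right_derivative\<close>). Left derivatives are avoided on purpose: they
  would require a bound on \<open>S\<close> that is uniform in \<open>t\<close>. A continuous function whose right derivative
  vanishes is constant (lemma \<open>zero_right_derivative_imp_constant\<close>), so
  \<open>exp (\<lambda>\<^sub>k t) \<langle>S t \<phi>\<^sub>k, G\<rangle>\<close> does not depend on \<open>t\<close>. As \<open>G\<close> is arbitrary,
  \<open>S t \<phi>\<^sub>k = exp (-\<lambda>\<^sub>k t) \<phi>\<^sub>k\<close> almost everywhere (lemma \<open>semigroup_eigenvector\<close>).

  Self-adjointness: a bounded operator with \<open>B \<phi>\<^sub>k = \<mu>\<^sub>k \<phi>\<^sub>k\<close> for an orthonormal basis \<open>\<phi>\<close> and real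
  \<open>\<mu>\<^sub>k\<close> satisfies \<open>\<langle>B F, G\<rangle> = lim (\<Sum>k=1..n. \<langle>F, \<phi>\<^sub>k\<rangle> \<mu>\<^sub>k \<langle>\<phi>\<^sub>k, G\<rangle>)\<close>, an expression symmetric in \<open>F\<close>
  and \<open>G\<close> (lemma \<open>diagonal_imp_self_adjoint\<close>).
\<close>

section \<open>Square-integrable functions\<close>

lemma sq_integrable_mult:
  assumes "f \<in> sq_integrable M" "g \<in> sq_integrable M"
  shows "integrable M (\<lambda>x. f x * g x)"
proof (rule Bochner_Integration.integrable_bound)
  show "integrable M (\<lambda>x. (f x)\<^sup>2 + (g x)\<^sup>2)"
    using assms by (auto simp: sq_integrable_def)
  show "(\<lambda>x. f x * g x) \<in> borel_measurable M"
    using assms by (auto simp: sq_integrable_def)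
  have "\<bar>a * b\<bar> \<le> a\<^sup>2 + b\<^sup>2" for a b :: real
  proof -
    have "2 * (\<bar>a\<bar> * \<bar>b\<bar>) \<le> a\<^sup>2 + b\<^sup>2"
      using zero_le_power2[of "\<bar>a\<bar> - \<bar>b\<bar>"] by (simp add: power2_diff)
    moreover have "0 \<le> \<bar>a\<bar> * \<bar>b\<bar>" by simp
    ultimately show ?thesis unfolding abs_mult by linarith
  qed
  then show "AE x in M. norm (f x * g x) \<le> norm ((f x)\<^sup>2 + (g x)\<^sup>2)"
    by simp
qed

lemma sq_integrable_add:
  assumes "f \<in> sq_integrable M" "g \<in> sq_integrable M"
  shows "(\<lambda>x. f x + g x) \<in> sq_integrable M"
proof -
  have "integrable M (\<lambda>x. (f x)\<^sup>2 + (g x)\<^sup>2 + 2 * (f x * g x))"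
    using assms sq_integrable_mult[OF assms] by (auto simp: sq_integrable_def)
  then show ?thesis
    using assms by (auto simp: sq_integrable_def power2_sum algebra_simps)
qed

lemma sq_integrable_scale:
  "f \<in> sq_integrable M \<Longrightarrow> (\<lambda>x. c * f x) \<in> sq_integrable M"
  by (auto simp: sq_integrable_def power_mult_distrib)

lemma L2_inner_add_left:
  assumes "f \<in> sq_integrable M" "g \<in> sq_integrable M" "h \<in> sq_integrable M"
  shows "L2_inner M (\<lambda>x. f x + g x) h = L2_inner M f h + L2_inner M g h"
  unfolding L2_inner_def
  by (simp add: distrib_right Bochner_Integration.integral_add sq_integrable_mult assms)

lemma L2_inner_cong:
  assumes "AE x in M. f x = g x"
    and "f \<in> sq_integrable M" "g \<in> sq_integrable M" "h \<in> sq_integrable M"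
  shows "L2_inner M f h = L2_inner M g h"
  unfolding L2_inner_def
proof (rule integral_cong_AE)
  show "AE x in M. f x * h x = g x * h x"
    using assms(1) by eventually_elim simp
qed (use assms in \<open>auto simp: sq_integrable_def\<close>)

lemma L2_inner_self_nonneg: "0 \<le> L2_inner M f f"
  unfolding L2_inner_def by (rule integral_nonneg_AE) simp

lemma L2_inner_self_zero_imp_AE:
  assumes "f \<in> sq_integrable M" "L2_inner M f f = 0"
  shows "AE x in M. f x = 0"
proof -
  have "AE x in M. f x * f x = 0"
    using assms sq_integrable_mult[OF assms(1,1)]
    by (subst (asm) L2_inner_def, subst (asm) integral_nonneg_eq_0_iff_AE) auto
  then show ?thesis by simp
qed


section \<open>The inner product space of states\<close>

lemma LL2_add: "F \<in> LL2 \<Omega> \<Longrightarrow> G \<in> LL2 \<Omega> \<Longrightarrow> st_add F G \<in> LL2 \<Omega>"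
  by (auto simp: LL2_def st_add_def intro: sq_integrable_add)

lemma LL2_scale: "F \<in> LL2 \<Omega> \<Longrightarrow> st_scale c F \<in> LL2 \<Omega>"
  by (auto simp: LL2_def st_scale_def intro: sq_integrable_scale)

lemma st_diff_eq: "st_diff F G = st_add F (st_scale (-1) G)"
  by (simp add: st_diff_def st_add_def st_scale_def)

lemma LL2_diff: "F \<in> LL2 \<Omega> \<Longrightarrow> G \<in> LL2 \<Omega> \<Longrightarrow> st_diff F G \<in> LL2 \<Omega>"
  by (simp add: st_diff_eq LL2_add LL2_scale)

lemma st_sum_empty: "st_sum F {} = ((\<lambda>x. 0), (\<lambda>x. 0))"
  by (simp add: st_sum_def)

lemma st_sum_insert:
  "finite K \<Longrightarrow> k \<notin> K \<Longrightarrow> st_sum F (insert k K) = st_add (F k) (st_sum F K)"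
  by (simp add: st_sum_def st_add_def)

lemma LL2_zero: "((\<lambda>x. 0), (\<lambda>x. 0)) \<in> LL2 \<Omega>"
  by (simp add: LL2_def sq_integrable_def)

lemma LL2_sum:
  "finite K \<Longrightarrow> (\<And>k. k \<in> K \<Longrightarrow> F k \<in> LL2 \<Omega>) \<Longrightarrow> st_sum F K \<in> LL2 \<Omega>"
  by (induction K rule: finite_induct) (auto simp: st_sum_empty st_sum_insert LL2_zero LL2_add)

lemma LL2_inner_commute: "LL2_inner \<Omega> F G = LL2_inner \<Omega> G F"
  by (simp add: LL2_inner_def L2_inner_def mult.commute)

lemma LL2_inner_add_left:
  "F \<in> LL2 \<Omega> \<Longrightarrow> G \<in> LL2 \<Omega> \<Longrightarrow> H \<in> LL2 \<Omega> \<Longrightarrow>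
    LL2_inner \<Omega> (st_add F G) H = LL2_inner \<Omega> F H + LL2_inner \<Omega> G H"
  by (auto simp: LL2_inner_def LL2_def st_add_def L2_inner_add_left)

lemma LL2_inner_scale_left: "LL2_inner \<Omega> (st_scale c F) H = c * LL2_inner \<Omega> F H"
  by (simp add: LL2_inner_def L2_inner_def st_scale_def mult.assoc distrib_left)

lemma LL2_inner_scale_right: "LL2_inner \<Omega> H (st_scale c F) = c * LL2_inner \<Omega> H F"
  using LL2_inner_scale_left LL2_inner_commute by metis

lemma LL2_inner_diff_left:
  "F \<in> LL2 \<Omega> \<Longrightarrow> G \<in> LL2 \<Omega> \<Longrightarrow> H \<in> LL2 \<Omega> \<Longrightarrow>
    LL2_inner \<Omega> (st_diff F G) H = LL2_inner \<Omega> F H - LL2_inner \<Omega> G H"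
  by (simp add: st_diff_eq LL2_inner_add_left LL2_scale LL2_inner_scale_left)

lemma LL2_inner_diff_right:
  "F \<in> LL2 \<Omega> \<Longrightarrow> G \<in> LL2 \<Omega> \<Longrightarrow> H \<in> LL2 \<Omega> \<Longrightarrow>
    LL2_inner \<Omega> H (st_diff F G) = LL2_inner \<Omega> H F - LL2_inner \<Omega> H G"
  using LL2_inner_diff_left LL2_inner_commute by metis

lemma LL2_inner_cong:
  "LL2_eq \<Omega> F G \<Longrightarrow> F \<in> LL2 \<Omega> \<Longrightarrow> G \<in> LL2 \<Omega> \<Longrightarrow> H \<in> LL2 \<Omega> \<Longrightarrow>
    LL2_inner \<Omega> F H = LL2_inner \<Omega> G H"
  unfolding LL2_inner_def LL2_eq_def LL2_def
  by (intro arg_cong2[where f = "(+)"] L2_inner_cong) auto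

lemma LL2_inner_self_nonneg: "0 \<le> LL2_inner \<Omega> F F"
  by (simp add: LL2_inner_def L2_inner_self_nonneg)

lemma LL2_norm_nonneg: "0 \<le> LL2_norm \<Omega> F"
  by (simp add: LL2_norm_def LL2_inner_self_nonneg)

lemma LL2_Cauchy_Schwarz:
  assumes F: "F \<in> LL2 \<Omega>" and G: "G \<in> LL2 \<Omega>"
  shows "\<bar>LL2_inner \<Omega> F G\<bar> \<le> LL2_norm \<Omega> F * LL2_norm \<Omega> G"
proof -
  let ?a = "LL2_inner \<Omega> F F" and ?b = "LL2_inner \<Omega> F G" and ?c = "LL2_inner \<Omega> G G"
  have quad: "0 \<le> ?a - 2 * t * ?b + t\<^sup>2 * ?c" for t
  proof -
    have "0 \<le> LL2_inner \<Omega> (st_diff F (st_scale t G)) (st_diff F (st_scale t G))"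
      by (rule LL2_inner_self_nonneg)
    also have "\<dots> = ?a - 2 * t * ?b + t\<^sup>2 * ?c"
      using F G LL2_inner_commute[of \<Omega> G F]
      by (simp add: LL2_inner_diff_left LL2_inner_diff_right LL2_diff LL2_scale
          LL2_inner_scale_left LL2_inner_scale_right algebra_simps power2_eq_square)
    finally show ?thesis .
  qed
  have "?b\<^sup>2 \<le> ?a * ?c"
  proof (cases "?c = 0")
    case True
    (* The quadratic is then affine in t; at the point chosen here it takes the value -1. *)
    have "?b = 0"
    proof (rule ccontr)
      assume "?b \<noteq> 0"
      then show False
        using quad[of "(?a + 1) / (2 * ?b)"] True by simp
    qed
    then show ?thesis using True by simp
  next
    case False
    then have c: "?c > 0" using LL2_inner_self_nonneg[of \<Omega> G] by simp
    have "0 \<le> ?a - ?b\<^sup>2 / ?c"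
      using quad[of "?b / ?c"] c by (simp add: power2_eq_square field_simps)
    then show ?thesis using c by (simp add: field_simps)
  qed
  then have "sqrt (?b\<^sup>2) \<le> sqrt (?a * ?c)" by (rule real_sqrt_le_mono)
  then show ?thesis by (simp add: LL2_norm_def real_sqrt_mult)
qed

lemma LL2_eq_if_inner_eq:
  assumes F: "F \<in> LL2 \<Omega>" and G: "G \<in> LL2 \<Omega>"
    and eq: "\<And>H. H \<in> LL2 \<Omega> \<Longrightarrow> LL2_inner \<Omega> F H = LL2_inner \<Omega> G H"
  shows "LL2_eq \<Omega> F G"
proof -
  let ?D = "st_diff F G"
  have D: "?D \<in> LL2 \<Omega>" using F G by (rule LL2_diff)
  have "LL2_inner \<Omega> ?D ?D = 0"
    using LL2_inner_diff_left[OF F G D] eq[OF D] by simp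
  then have "L2_inner (lebesgue_on \<Omega>) (fst ?D) (fst ?D) = 0"
    "L2_inner (surface_measure \<Omega>) (snd ?D) (snd ?D) = 0"
    using L2_inner_self_nonneg[of "lebesgue_on \<Omega>" "fst ?D"]
      L2_inner_self_nonneg[of "surface_measure \<Omega>" "snd ?D"]
    by (auto simp: LL2_inner_def)
  with D have "AE x in lebesgue_on \<Omega>. fst ?D x = 0" "AE p in surface_measure \<Omega>. snd ?D p = 0"
    by (auto simp: LL2_def intro!: L2_inner_self_zero_imp_AE)
  then show ?thesis by (simp add: LL2_eq_def st_diff_def)
qed


section \<open>Bounded operators in weak form\<close>

text \<open>
  A bounded linear operator \<open>B\<close> is linear only up to null sets. Its matrix elements
  \<open>\<langle>B F, H\<rangle>\<close>, however, are genuinely linear in \<open>F\<close>, so all later computations are done with them.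
\<close>

lemma bounded_linear_closed:
  "LL2_bounded_linear \<Omega> B \<Longrightarrow> F \<in> LL2 \<Omega> \<Longrightarrow> B F \<in> LL2 \<Omega>"
  by (simp add: LL2_bounded_linear_def)

lemma inner_op_add:
  assumes B: "LL2_bounded_linear \<Omega> B" and FGH: "F \<in> LL2 \<Omega>" "G \<in> LL2 \<Omega>" "H \<in> LL2 \<Omega>"
  shows "LL2_inner \<Omega> (B (st_add F G)) H = LL2_inner \<Omega> (B F) H + LL2_inner \<Omega> (B G) H"
proof -
  have "LL2_eq \<Omega> (B (st_add F G)) (st_add (B F) (B G))"
    using B FGH by (simp add: LL2_bounded_linear_def)
  from LL2_inner_cong[OF this] show ?thesis
    using FGH by (simp add: LL2_add bounded_linear_closed[OF B] LL2_inner_add_left)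
qed

lemma inner_op_scale:
  assumes B: "LL2_bounded_linear \<Omega> B" and FH: "F \<in> LL2 \<Omega>" "H \<in> LL2 \<Omega>"
  shows "LL2_inner \<Omega> (B (st_scale c F)) H = c * LL2_inner \<Omega> (B F) H"
proof -
  have "LL2_eq \<Omega> (B (st_scale c F)) (st_scale c (B F))"
    using B FH by (simp add: LL2_bounded_linear_def)
  from LL2_inner_cong[OF this] show ?thesis
    using FH by (simp add: LL2_scale bounded_linear_closed[OF B] LL2_inner_scale_left)
qed

lemma inner_op_diff:
  assumes "LL2_bounded_linear \<Omega> B" "F \<in> LL2 \<Omega>" "G \<in> LL2 \<Omega>" "H \<in> LL2 \<Omega>"
  shows "LL2_inner \<Omega> (B (st_diff F G)) H = LL2_inner \<Omega> (B F) H - LL2_inner \<Omega> (B G) H"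
  using assms by (simp add: st_diff_eq inner_op_add inner_op_scale LL2_scale)

lemma inner_op_sum:
  assumes B: "LL2_bounded_linear \<Omega> B" and H: "H \<in> LL2 \<Omega>"
    and "finite K" "\<And>k. k \<in> K \<Longrightarrow> F k \<in> LL2 \<Omega>"
  shows "LL2_inner \<Omega> (B (st_sum F K)) H = (\<Sum>k\<in>K. LL2_inner \<Omega> (B (F k)) H)"
  using assms(3,4)
proof (induction K rule: finite_induct)
  case empty
  have "st_sum F {} = st_scale 0 (st_sum F {})" by (simp add: st_sum_empty st_scale_def)
  then show ?case
    using inner_op_scale[OF B LL2_zero H, of 0] by (simp add: st_sum_empty)
next
  case (insert k K)
  then show ?case
    by (simp add: st_sum_insert inner_op_add[OF B _ _ H] LL2_sum)
qed

lemma inner_op_bounded: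
  assumes B: "LL2_bounded_linear \<Omega> B" and H: "H \<in> LL2 \<Omega>"
  obtains K where "\<And>F. F \<in> LL2 \<Omega> \<Longrightarrow> \<bar>LL2_inner \<Omega> (B F) H\<bar> \<le> K * LL2_norm \<Omega> F"
proof -
  from B obtain C where C: "\<And>F. F \<in> LL2 \<Omega> \<Longrightarrow> LL2_norm \<Omega> (B F) \<le> C * LL2_norm \<Omega> F"
    unfolding LL2_bounded_linear_def by blast
  have "\<bar>LL2_inner \<Omega> (B F) H\<bar> \<le> C * LL2_norm \<Omega> H * LL2_norm \<Omega> F" if F: "F \<in> LL2 \<Omega>" for F
  proof -
    have "\<bar>LL2_inner \<Omega> (B F) H\<bar> \<le> LL2_norm \<Omega> (B F) * LL2_norm \<Omega> H"
      using LL2_Cauchy_Schwarz[OF bounded_linear_closed[OF B F] H] .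
    also have "\<dots> \<le> C * LL2_norm \<Omega> F * LL2_norm \<Omega> H"
      using C[OF F] LL2_norm_nonneg by (rule mult_right_mono)
    finally show ?thesis by (simp add: mult_ac)
  qed
  then show thesis by (rule that)
qed

lemma inner_op_tendsto_0:
  assumes B: "LL2_bounded_linear \<Omega> B" and H: "H \<in> LL2 \<Omega>"
    and X: "eventually (\<lambda>n. X n \<in> LL2 \<Omega>) net"
    and lim: "((\<lambda>n. LL2_norm \<Omega> (X n)) \<longlongrightarrow> 0) net"
  shows "((\<lambda>n. LL2_inner \<Omega> (B (X n)) H) \<longlongrightarrow> 0) net"
proof -
  obtain K where K: "\<And>F. F \<in> LL2 \<Omega> \<Longrightarrow> \<bar>LL2_inner \<Omega> (B F) H\<bar> \<le> K * LL2_norm \<Omega> F"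
    using inner_op_bounded[OF B H] by blast
  show ?thesis
  proof (rule Lim_null_comparison)
    show "\<forall>\<^sub>F n in net. norm (LL2_inner \<Omega> (B (X n)) H) \<le> K * LL2_norm \<Omega> (X n)"
      using X by eventually_elim (simp add: K)
    show "((\<lambda>n. K * LL2_norm \<Omega> (X n)) \<longlongrightarrow> 0) net"
      using tendsto_mult_left[OF lim, of K] by simp
  qed
qed


section \<open>Operators diagonal in an orthonormal basis\<close>

text \<open>
  Expand \<open>F\<close> in the basis. The partial sums converge to \<open>F\<close> in norm, and \<open>\<langle>B F, G\<rangle>\<close> depends
  continuously on \<open>F\<close> because \<open>B\<close> is bounded.
\<close>

lemma diagonal_inner_limit:
  assumes B: "LL2_bounded_linear \<Omega> B" and basis: "LL2_orthonormal_basis \<Omega> \<phi>"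
    and diag: "\<And>k. k \<ge> 1 \<Longrightarrow> LL2_eq \<Omega> (B (\<phi> k)) (st_scale (\<mu> k) (\<phi> k))"
    and F: "F \<in> LL2 \<Omega>" and G: "G \<in> LL2 \<Omega>"
  shows "(\<lambda>n. \<Sum>k=1..n. LL2_inner \<Omega> F (\<phi> k) * (\<mu> k * LL2_inner \<Omega> G (\<phi> k)))
           \<longlonglongrightarrow> LL2_inner \<Omega> (B F) G"
proof -
  define P where "P n = st_sum (\<lambda>k. st_scale (LL2_inner \<Omega> F (\<phi> k)) (\<phi> k)) {1..n}" for n :: nat
  have \<phi>: "\<phi> k \<in> LL2 \<Omega>" if "k \<ge> 1" for k
    using basis that by (simp add: LL2_orthonormal_basis_def)
  have P: "P n \<in> LL2 \<Omega>" for n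
    unfolding P_def by (rule LL2_sum) (simp_all add: LL2_scale \<phi>)
  have "(\<lambda>n. LL2_norm \<Omega> (st_diff F (P n))) \<longlonglongrightarrow> 0"
    using basis F by (simp add: LL2_orthonormal_basis_def P_def)
  then have "(\<lambda>n. LL2_inner \<Omega> (B (st_diff F (P n))) G) \<longlonglongrightarrow> 0"
    by (intro inner_op_tendsto_0[OF B G] always_eventually allI LL2_diff F P)
  then have "(\<lambda>n. LL2_inner \<Omega> (B F) G - LL2_inner \<Omega> (B (P n)) G) \<longlonglongrightarrow> 0"
    by (simp add: inner_op_diff[OF B F P G])
  from tendsto_diff[OF tendsto_const[of "LL2_inner \<Omega> (B F) G"] this]
  have "(\<lambda>n. LL2_inner \<Omega> (B (P n)) G) \<longlonglongrightarrow> LL2_inner \<Omega> (B F) G"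
    by simp
  moreover have "LL2_inner \<Omega> (B (P n)) G =
      (\<Sum>k=1..n. LL2_inner \<Omega> F (\<phi> k) * (\<mu> k * LL2_inner \<Omega> G (\<phi> k)))" for n
  proof -
    have "LL2_inner \<Omega> (B (P n)) G =
        (\<Sum>k=1..n. LL2_inner \<Omega> (B (st_scale (LL2_inner \<Omega> F (\<phi> k)) (\<phi> k))) G)"
      unfolding P_def by (rule inner_op_sum[OF B G]) (simp_all add: LL2_scale \<phi>)
    also have "\<dots> = (\<Sum>k=1..n. LL2_inner \<Omega> F (\<phi> k) * (\<mu> k * LL2_inner \<Omega> G (\<phi> k)))"
    proof (rule sum.cong[OF refl])
      fix k assume "k \<in> {1..n}"
      then have k: "k \<ge> 1" by simp
      have "LL2_inner \<Omega> (B (\<phi> k)) G = \<mu> k * LL2_inner \<Omega> G (\<phi> k)"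
        using LL2_inner_cong[OF diag[OF k] bounded_linear_closed[OF B \<phi>[OF k]]
            LL2_scale[OF \<phi>[OF k]] G]
        by (simp add: LL2_inner_scale_left LL2_inner_commute[of \<Omega> G])
      then show "LL2_inner \<Omega> (B (st_scale (LL2_inner \<Omega> F (\<phi> k)) (\<phi> k))) G =
          LL2_inner \<Omega> F (\<phi> k) * (\<mu> k * LL2_inner \<Omega> G (\<phi> k))"
        by (simp add: inner_op_scale[OF B \<phi>[OF k] G])
    qed
    finally show ?thesis .
  qed
  ultimately show ?thesis by simp
qed

text \<open>
  The partial sums that converge to \<open>\<langle>B F, G\<rangle>\<close> are unchanged when \<open>F\<close> and \<open>G\<close> are
  interchanged, because the \<open>\<mu> k\<close> are real.
\<close>

lemma diagonal_imp_self_adjoint: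
  assumes B: "LL2_bounded_linear \<Omega> B" and basis: "LL2_orthonormal_basis \<Omega> \<phi>"
    and diag: "\<And>k. k \<ge> 1 \<Longrightarrow> LL2_eq \<Omega> (B (\<phi> k)) (st_scale (\<mu> k) (\<phi> k))"
  shows "LL2_self_adjoint \<Omega> B"
proof -
  have "LL2_inner \<Omega> (B F) G = LL2_inner \<Omega> F (B G)" if F: "F \<in> LL2 \<Omega>" and G: "G \<in> LL2 \<Omega>" for F G
  proof -
    have "(\<lambda>n. \<Sum>k=1..n. LL2_inner \<Omega> F (\<phi> k) * (\<mu> k * LL2_inner \<Omega> G (\<phi> k)))
        \<longlonglongrightarrow> LL2_inner \<Omega> (B G) F"
      using diagonal_inner_limit[OF B basis diag G F] by (simp add: mult_ac)
    with diagonal_inner_limit[OF B basis diag F G]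
    have "LL2_inner \<Omega> (B F) G = LL2_inner \<Omega> (B G) F"
      by (rule LIMSEQ_unique)
    then show ?thesis by (simp add: LL2_inner_commute)
  qed
  with B show ?thesis by (simp add: LL2_self_adjoint_def)
qed


section \<open>Functions determined by their right derivative\<close>

text \<open>
  For every \<open>e > 0\<close> the set of \<open>t\<close> with \<open>\<bar>g t - g a\<bar> \<le> e (t - a)\<close> is closed, and by the vanishing
  right derivative at its largest element it extends further to the right unless that element is
  already \<open>b\<close>.
\<close>

lemma zero_right_derivative_imp_constant:
  fixes g :: "real \<Rightarrow> real"
  assumes "a \<le> b" and cont: "continuous_on {a..b} g"
    and der: "\<And>t. a \<le> t \<Longrightarrow> t < b \<Longrightarrow> (g has_real_derivative 0) (at_right t)"
  shows "g b = g a"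
proof -
  have bound: "\<bar>g b - g a\<bar> \<le> e * (b - a)" if e: "e > 0" for e
  proof -
    define A where "A = {t \<in> {a..b}. \<bar>g t - g a\<bar> \<le> e * (t - a)}"
    define s where "s = Sup A"
    have "a \<in> A" using \<open>a \<le> b\<close> by (simp add: A_def)
    have bdd: "bdd_above A" by (rule bdd_aboveI[of _ b]) (simp add: A_def)
    have "closed A"
      unfolding A_def by (intro continuous_on_closed_Collect_le continuous_intros cont closed_atLeastAtMost)
    then have "s \<in> A"
      unfolding s_def using \<open>a \<in> A\<close> bdd by (intro closed_contains_Sup) auto
    then have s: "a \<le> s" "s \<le> b" "\<bar>g s - g a\<bar> \<le> e * (s - a)" by (auto simp: A_def)
    have "s = b"
    proof (rule ccontr)
      assume "s \<noteq> b"
      with s have "s < b" by simp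
      have "((\<lambda>y. (g y - g s) / (y - s)) \<longlongrightarrow> 0) (at_right s)"
        using der[OF s(1) \<open>s < b\<close>] by (simp add: has_field_derivative_iff)
      from tendstoD[OF this e]
      have "\<forall>\<^sub>F y in at_right s. \<bar>(g y - g s) / (y - s)\<bar> < e" by simp
      moreover have "\<forall>\<^sub>F y in at_right s. y < b"
        using \<open>s < b\<close> by (auto simp: eventually_at_right_field)
      moreover have "\<forall>\<^sub>F y in at_right s. s < y"
        by (rule eventually_at_right_less)
      ultimately have "\<forall>\<^sub>F y in at_right s. y \<in> A \<and> s < y"
      proof eventually_elim
        case (elim y)
        then have "\<bar>g y - g s\<bar> \<le> e * (y - s)" by (simp add: abs_divide field_simps)
        moreover have "e * (y - s) + e * (s - a) = e * (y - a)" by (simp add: algebra_simps)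
        ultimately have "\<bar>g y - g a\<bar> \<le> e * (y - a)" using s(3) by linarith
        then show ?case using elim s(1) by (simp add: A_def)
      qed
      then obtain y where "y \<in> A" "s < y"
        using eventually_happens trivial_limit_at_right_real by blast
      moreover have "y \<le> s" unfolding s_def using \<open>y \<in> A\<close> bdd by (rule cSup_upper)
      ultimately show False by simp
    qed
    then show ?thesis using s(3) by simp
  qed
  have "\<bar>g b - g a\<bar> \<le> 0"
  proof (rule field_le_epsilon)
    fix e :: real assume "e > 0"
    have "\<bar>g b - g a\<bar> \<le> e / (b - a + 1) * (b - a)"
      using \<open>e > 0\<close> \<open>a \<le> b\<close> by (intro bound) simp
    also have "\<dots> \<le> e" using \<open>e > 0\<close> \<open>a \<le> b\<close> by (simp add: field_simps)
    finally show "\<bar>g b - g a\<bar> \<le> 0 + e" by simp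
  qed
  then show ?thesis by simp
qed

text \<open>
  The integrating factor \<open>exp (- c t)\<close> turns the equation \<open>f' = c f\<close> into a vanishing right
  derivative.
\<close>

lemma right_derivative_linear_ode:
  fixes f :: "real \<Rightarrow> real"
  assumes "0 \<le> T" and cont: "continuous_on {0..T} f"
    and der: "\<And>t. 0 \<le> t \<Longrightarrow> t < T \<Longrightarrow> (f has_real_derivative c * f t) (at_right t)"
  shows "f T = exp (c * T) * f 0"
proof -
  have "exp (- c * T) * f T = exp (- c * 0) * f 0"
  proof (rule zero_right_derivative_imp_constant[where g = "\<lambda>t. exp (- c * t) * f t"])
    show "continuous_on {0..T} (\<lambda>t. exp (- c * t) * f t)"
      by (intro continuous_intros cont)
    show "((\<lambda>t. exp (- c * t) * f t) has_real_derivative 0) (at_right t)"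
      if "0 \<le> t" "t < T" for t
      using der[OF that] by (auto intro!: derivative_eq_intros)
  qed (fact \<open>0 \<le> T\<close>)
  then show ?thesis by (simp add: exp_minus field_simps)
qed


section \<open>Semigroup orbits of eigenvectors\<close>

lemma orbit_continuous:
  assumes S: "C0_semigroup \<Omega> S" and F: "F \<in> LL2 \<Omega>" and G: "G \<in> LL2 \<Omega>"
  shows "continuous_on {0..} (\<lambda>t. LL2_inner \<Omega> (S t F) G)"
  unfolding continuous_on
proof
  fix t :: real assume t: "t \<in> {0..}"
  have mem: "S s F \<in> LL2 \<Omega>" if "s \<ge> 0" for s
    using S F that by (simp add: C0_semigroup_def bounded_linear_closed[of \<Omega> "S s"])
  have id: "LL2_bounded_linear \<Omega> (\<lambda>F. F)"
    by (auto simp: LL2_bounded_linear_def LL2_eq_def intro: exI[of _ 1])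
  have nonneg: "\<forall>\<^sub>F s in at t within {0..}. s \<ge> 0"
    by (auto simp: eventually_at_filter)
  have "((\<lambda>s. LL2_norm \<Omega> (st_diff (S s F) (S t F))) \<longlongrightarrow> 0) (at t within {0..})"
    using S F t by (simp add: C0_semigroup_def)
  then have "((\<lambda>s. LL2_inner \<Omega> (st_diff (S s F) (S t F)) G) \<longlongrightarrow> 0) (at t within {0..})"
    using nonneg t by (intro inner_op_tendsto_0[OF id G]) (auto elim!: eventually_mono intro: LL2_diff mem)
  moreover have "\<forall>\<^sub>F s in at t within {0..}. LL2_inner \<Omega> (st_diff (S s F) (S t F)) G
      = LL2_inner \<Omega> (S s F) G - LL2_inner \<Omega> (S t F) G"
    using nonneg t by (auto elim!: eventually_mono intro: LL2_inner_diff_left mem G)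
  ultimately have "((\<lambda>s. LL2_inner \<Omega> (S s F) G - LL2_inner \<Omega> (S t F) G) \<longlongrightarrow> 0) (at t within {0..})"
    by (rule Lim_transform_eventually)
  then show "((\<lambda>s. LL2_inner \<Omega> (S s F) G) \<longlongrightarrow> LL2_inner \<Omega> (S t F) G) (at t within {0..})"
    by (rule LIM_zero_cancel)
qed

text \<open>
  The difference quotient of the orbit at \<open>t\<close> is \<open>S t\<close> applied to the one at \<open>0\<close>, which converges to
  the generator's value; \<open>S t\<close> is a single bounded operator, so the limit passes through it.
\<close>

lemma orbit_right_derivative:
  assumes S: "C0_semigroup \<Omega> S" and gen: "(F, Z) \<in> generator_graph \<Omega> S"
    and G: "G \<in> LL2 \<Omega>" and t: "t \<ge> 0"
  shows "((\<lambda>t. LL2_inner \<Omega> (S t F) G) has_real_derivative LL2_inner \<Omega> (S t Z) G) (at_right t)"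
proof -
  let ?f = "\<lambda>t. LL2_inner \<Omega> (S t F) G"
  let ?X = "\<lambda>h. st_diff (st_scale (1 / h) (st_diff (S h F) F)) Z"
  from gen have F: "F \<in> LL2 \<Omega>" and Z: "Z \<in> LL2 \<Omega>"
    and lim: "((\<lambda>h. LL2_norm \<Omega> (?X h)) \<longlongrightarrow> 0) (at_right 0)"
    by (auto simp: generator_graph_def)
  have bl: "LL2_bounded_linear \<Omega> (S s)" if "s \<ge> 0" for s
    using S that by (simp add: C0_semigroup_def)
  have mem: "S s H \<in> LL2 \<Omega>" if "s \<ge> 0" "H \<in> LL2 \<Omega>" for s H
    using bounded_linear_closed[OF bl] that by blast
  have pos: "\<forall>\<^sub>F h in at_right 0. (0::real) < h" by (rule eventually_at_right_less)
  have "((\<lambda>h. LL2_inner \<Omega> (S t (?X h)) G) \<longlongrightarrow> 0) (at_right 0)"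
    using pos by (intro inner_op_tendsto_0[OF bl[OF t] G _ lim])
      (auto elim!: eventually_mono intro!: LL2_diff LL2_scale mem F Z)
  moreover have "\<forall>\<^sub>F h in at_right 0. LL2_inner \<Omega> (S t (?X h)) G
      = (?f (h + t) - ?f t) / h - LL2_inner \<Omega> (S t Z) G"
    using pos
  proof eventually_elim
    case (elim h)
    have "LL2_eq \<Omega> (S (t + h) F) (S t (S h F))"
      using S F t elim by (simp add: C0_semigroup_def)
    then have "?f (h + t) = LL2_inner \<Omega> (S t (S h F)) G"
      using t elim F G by (subst add.commute) (intro LL2_inner_cong mem, auto)
    then show ?case
      using t elim F G Z
      by (simp add: inner_op_diff[OF bl[OF t]] inner_op_scale[OF bl[OF t]] LL2_diff LL2_scale mem
          diff_divide_distrib)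
  qed
  ultimately have "((\<lambda>h. (?f (h + t) - ?f t) / h - LL2_inner \<Omega> (S t Z) G) \<longlongrightarrow> 0) (at_right 0)"
    by (rule Lim_transform_eventually)
  then have "((\<lambda>h. (?f (h + t) - ?f t) / h) \<longlongrightarrow> LL2_inner \<Omega> (S t Z) G) (at_right 0)"
    by (rule LIM_zero_cancel)
  then show ?thesis
    by (simp add: has_field_derivative_iff filterlim_at_right_to_0[where a = t])
qed

text \<open>
  When \<open>F\<close> is an eigenvector of the generator, every matrix element \<open>\<langle>S t F, G\<rangle>\<close> solves the scalar
  equation \<open>f' = c f\<close> from the right, and these matrix elements determine \<open>S T F\<close>.
\<close>

lemma semigroup_eigenvector:
  assumes S: "C0_semigroup \<Omega> S" and gen: "(F, st_scale c F) \<in> generator_graph \<Omega> S"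
    and T: "T \<ge> 0"
  shows "LL2_eq \<Omega> (S T F) (st_scale (exp (c * T)) F)"
proof (rule LL2_eq_if_inner_eq)
  have bl: "LL2_bounded_linear \<Omega> (S s)" if "s \<ge> 0" for s
    using S that by (simp add: C0_semigroup_def)
  from gen have F: "F \<in> LL2 \<Omega>" by (simp add: generator_graph_def)
  show "S T F \<in> LL2 \<Omega>" using bounded_linear_closed[OF bl[OF T] F] .
  show "st_scale (exp (c * T)) F \<in> LL2 \<Omega>" using F by (rule LL2_scale)
  fix G assume G: "G \<in> LL2 \<Omega>"
  have "LL2_inner \<Omega> (S T F) G = exp (c * T) * LL2_inner \<Omega> (S 0 F) G"
  proof (rule right_derivative_linear_ode[OF T])
    show "continuous_on {0..T} (\<lambda>t. LL2_inner \<Omega> (S t F) G)"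
      using orbit_continuous[OF S F G] by (rule continuous_on_subset) auto
    show "((\<lambda>t. LL2_inner \<Omega> (S t F) G) has_real_derivative c * LL2_inner \<Omega> (S t F) G)
        (at_right t)" if "0 \<le> t" for t
      using orbit_right_derivative[OF S gen G that] inner_op_scale[OF bl[OF that] F G] by simp
  qed
  also have "LL2_inner \<Omega> (S 0 F) G = LL2_inner \<Omega> F G"
    using S F G bounded_linear_closed[OF bl F, of 0]
    by (intro LL2_inner_cong) (auto simp: C0_semigroup_def)
  finally show "LL2_inner \<Omega> (S T F) G = LL2_inner \<Omega> (st_scale (exp (c * T)) F) G"
    by (simp add: LL2_inner_scale_left)
qed


section \<open>The input-output operator\<close>

theorem lemma4p1:
  fixes \<Omega> :: "'a::euclidean_space set"
    and T d \<gamma> :: real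
    and lam :: "nat \<Rightarrow> real"
    and \<phi> :: "nat \<Rightarrow> 'a state"
  assumes "T > 0"
    and "C2_bounded_domain \<Omega>"
    and "d > 0"
    and "DIM('a) \<ge> 2 \<Longrightarrow> \<gamma> > 0"
    and "DIM('a) = 1 \<Longrightarrow> \<gamma> = 0"
    and "generates_C0_semigroup \<Omega> (HH2 \<Omega>) (A0 \<Omega> d \<gamma>)"
    and "eigenbasis \<Omega> d \<gamma> lam \<phi>"
  shows "LL2_self_adjoint \<Omega> (input_output \<Omega> d \<gamma> T) \<and>
    (\<forall>k\<ge>1. LL2_eq \<Omega> (input_output \<Omega> d \<gamma> T (\<phi> k)) (st_scale (exp (- lam k * T)) (\<phi> k)))"
proof -
  define S where "S = exp_semigroup \<Omega> (HH2 \<Omega>) (A0 \<Omega> d \<gamma>)"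
  have "generated_by \<Omega> (HH2 \<Omega>) (A0 \<Omega> d \<gamma>) S"
    using assms(6) unfolding generates_C0_semigroup_def S_def exp_semigroup_def
    by (rule someI_ex)
  then have S: "C0_semigroup \<Omega> S"
    and graph: "generator_graph \<Omega> S =
      {(F, Z). F \<in> HH2 \<Omega> \<and> Z \<in> LL2 \<Omega> \<and> LL2_eq \<Omega> Z (A0 \<Omega> d \<gamma> F)}"
    by (auto simp: generated_by_def)
  have \<Psi>: "input_output \<Omega> d \<gamma> T = S T"
    by (simp add: fun_eq_iff input_output_def mild_solution_def S_def)
  from assms(7) have basis: "LL2_orthonormal_basis \<Omega> \<phi>"
    by (simp add: eigenbasis_def)
  have eig: "LL2_eq \<Omega> (S T (\<phi> k)) (st_scale (exp (- lam k * T)) (\<phi> k))" if k: "k \<ge> 1" for k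
  proof (rule semigroup_eigenvector[OF S])
    have "LL2_eq \<Omega> (st_scale (-1) (A0 \<Omega> d \<gamma> (\<phi> k))) (st_scale (lam k) (\<phi> k))"
      using assms(7) k by (simp add: eigenbasis_def)
    then have "LL2_eq \<Omega> (st_scale (- lam k) (\<phi> k)) (A0 \<Omega> d \<gamma> (\<phi> k))"
      unfolding LL2_eq_def st_scale_def by (auto elim!: eventually_mono)
    then show "(\<phi> k, st_scale (- lam k) (\<phi> k)) \<in> generator_graph \<Omega> S"
      using assms(7) basis k
      by (simp add: graph eigenbasis_def LL2_orthonormal_basis_def LL2_scale)
  qed (use \<open>T > 0\<close> in simp)
  have "LL2_bounded_linear \<Omega> (S T)"
    using S \<open>T > 0\<close> by (simp add: C0_semigroup_def)
  from diagonal_imp_self_adjoint[OF this basis eig] eig show ?thesis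
    by (simp add: \<Psi>)
qed

end
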